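(* Let $n_1<n_2<n_3$ be positive integers with $\gcd(n_1,n_2,n_3)=1$ that minimally generate the numerical semigroup $S=\langle n_1,n_2,n_3\rangle$, and assume $S$ is not symmetric. Let $\delta_1=c_1-r_{12}-r_{13}$, $\delta_3=r_{31}+r_{32}-c_3$ and $g=\gcd(\delta_1,\delta_3)$. Then \[ \Delta(S)=\Big\{\, g\,i \;:\; i\in\{1,\ldots,\max\{\delta_1/g,\delta_3/g\}\},\ \text{the }\lambda\text{-B\'ezout couple of } i \text{ or the }\mu\text{-B\'ezout couple of } i \text{ for } (\delta_1/g,\delta_3/g) \text{ is irreducible}\Big\}. \]
   Context: $S=\langle n_1,n_2,n_3\rangle=\{x_1n_1+x_2n_2+x_3n_3 : x_i\in\mathbb N\}$; minimally generated means no $n_i$ lies in the submonoid generated by the other two. With $F=\max(\mathbb Z\setminus S)$, $S$ is symmetric if $x\in\mathbb Z\setminus S$ implies $F-x\in S$. For $\{i,j,k\}=\{1,2,3\}$, $c_i=\min\{c\in\mathbb Z^+ : cn_i\in\langle n_j,n_k\rangle\}$; when $S$ is not symmetric there are unique positive integers $r_{ij},r_{ik}$ with $c_in_i=r_{ij}n_j+r_{ik}n_k$ (and then $\delta_1,\delta_3$ are positive integers). For $s\in S$, the set of lengths is $\mathcal L(s)=\{x_1+x_2+x_3 : (x_1,x_2,x_3)\in\mathbb N^3,\ x_1n_1+x_2n_2+x_3n_3=s\}=\{m_1<\dots<m_k\}$, $\Delta(s)=\{m_t-m_{t-1}:2\le t\le k\}$, and $\Delta(S)=\bigcup_{s\in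 S}\Delta(s)$. B\'ezout couples: for coprime positive integers $p,q$ and $i\in\{1,\ldots,\max\{p,q\}\}$, the $\lambda$-B\'ezout couple of $i$ for $(p,q)$ is the unique $(x,y)\in\mathbb Z^2$ with $xp+yq=i$ and $0<y\le p$; the $\mu$-B\'ezout couple of $i$ for $(p,q)$ is the unique $(x,y)\in\mathbb Z^2$ with $xp+yq=i$ and $0<x\le q$. The $\lambda$-B\'ezout couple $\boldsymbol\lambda_i$ of $i$ is irreducible if there are no $j,k\in\{1,\ldots,\max\{p,q\}\}$ with $\boldsymbol\lambda_i=\boldsymbol\lambda_j+\boldsymbol\lambda_k$ (sum in $\mathbb Z^2$ of the $\lambda$-B\'ezout couples of $j$ and $k$); irreducibility of $\mu$-B\'ezout couples is defined in the same way using $\mu$-B\'ezout couples. *)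

theory Defs
  imports Main
begin

definition sg2 :: "nat \<Rightarrow> nat \<Rightarrow> nat set" where
  "sg2 a b = {x * a + y * b | x y. True}"

definition sg3 :: "nat \<Rightarrow> nat \<Rightarrow> nat \<Rightarrow> nat set" where
  "sg3 a b c = {x1 * a + x2 * b + x3 * c | x1 x2 x3. True}"

definition minimally_generated :: "nat \<Rightarrow> nat \<Rightarrow> nat \<Rightarrow> bool" where
  "minimally_generated a b c \<longleftrightarrow>
     a \<notin> sg2 b c \<and> b \<notin> sg2 a c \<and> c \<notin> sg2 a b"

definition frobenius :: "nat set \<Rightarrow> int" where
  "frobenius S = (GREATEST x::int. x \<notin> int ` S)"

definition symmetric_sg :: "nat set \<Rightarrow> bool" where
  "symmetric_sg S \<longleftrightarrow> (\<forall>x::int. x \<notin> int ` S \<longrightarrow> frobenius S - x \<in> int ` S)"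

definition cmin :: "nat \<Rightarrow> nat \<Rightarrow> nat \<Rightarrow> nat" where
  "cmin a b c = (LEAST m::nat. 0 < m \<and> m * a \<in> sg2 b c)"

definition rpair :: "nat \<Rightarrow> nat \<Rightarrow> nat \<Rightarrow> nat \<times> nat" where
  "rpair a b c = (THE (u, v). 0 < u \<and> 0 < v \<and> cmin a b c * a = u * b + v * c)"

definition lengths :: "nat \<Rightarrow> nat \<Rightarrow> nat \<Rightarrow> nat \<Rightarrow> nat set" where
  "lengths n1 n2 n3 s =
     {x1 + x2 + x3 | x1 x2 x3. x1 * n1 + x2 * n2 + x3 * n3 = s}"

definition delta_elem :: "nat set \<Rightarrow> int set" where
  "delta_elem L = {int b - int a | a b. a \<in> L \<and> b \<in> L \<and> a < b \<and>
                       \<not> (\<exists>m\<in>L. a < m \<and> m < b)}"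

definition delta_set :: "nat \<Rightarrow> nat \<Rightarrow> nat \<Rightarrow> int set" where
  "delta_set n1 n2 n3 = (\<Union>s\<in>sg3 n1 n2 n3. delta_elem (lengths n1 n2 n3 s))"

text \<open>Bezout couples for coprime positive p, q and i \<in> {1..max p q}.\<close>
definition lambda_bez :: "int \<Rightarrow> int \<Rightarrow> int \<Rightarrow> int \<times> int" where
  "lambda_bez p q i = (THE (x, y). x * p + y * q = i \<and> 0 < y \<and> y \<le> p)"

definition mu_bez :: "int \<Rightarrow> int \<Rightarrow> int \<Rightarrow> int \<times> int" where
  "mu_bez p q i = (THE (x, y). x * p + y * q = i \<and> 0 < x \<and> x \<le> q)"

definition padd :: "int \<times> int \<Rightarrow> int \<times> int \<Rightarrow> int \<times> int" where
  "padd u v = (fst u + fst v, snd u + snd v)"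

definition lambda_irred :: "int \<Rightarrow> int \<Rightarrow> int \<Rightarrow> bool" where
  "lambda_irred p q i \<longleftrightarrow>
     \<not> (\<exists>j\<in>{1..max p q}. \<exists>k\<in>{1..max p q}.
          lambda_bez p q i = padd (lambda_bez p q j) (lambda_bez p q k))"

definition mu_irred :: "int \<Rightarrow> int \<Rightarrow> int \<Rightarrow> bool" where
  "mu_irred p q i \<longleftrightarrow>
     \<not> (\<exists>j\<in>{1..max p q}. \<exists>k\<in>{1..max p q}.
          mu_bez p q i = padd (mu_bez p q j) (mu_bez p q k))"

end

theory Submission
  imports Defs
begin

text \<open>
  Since S is not symmetric, the lattice of integer relations x n1 + y n2 + z n3 = 0 is freely
  generated by v1 = (c1, -r12, -r13) and v3 = (-r31, -r32, c3) (Herzog). Measured by the coordinate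
  sum, v1 has length \<delta>1 > 0 and v3 has length -\<delta>3 < 0. A number d > 0 lies in the delta set
  iff some relation z of length d is a gap: no relation w with 0 < length w < d satisfies
  w \<ge> min 0 z coordinatewise. Write z = a v1 + b v3. If a > 0 > b, then w = -v3 is admissible. Hence
  z = x v1 + y v3 or z = -(x v1 + y v3) with x, y \<ge> 0; the second case reduces to the first one by
  replacing w by z - w and exchanging v1 and v3. In the first case z is a gap iff it is not a sum of
  two vectors of the same kind and of positive length, because such vectors have positive first
  coordinate and because an indecomposable one has length at most \<delta>1. After division by
  gcd \<delta>1 \<delta>3 and reduction modulo the relation of length 0, the indecomposable vectors of the two
  kinds are the irreducible mu- and lambda-couples.
\<close>

section \<open>Bezout couples\<close>

lemma coprime_linear_eqE:
  fixes a b x y x' y' :: "'a::ring_gcd"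
  assumes "coprime a b" "b \<noteq> 0" "x * a + y * b = x' * a + y' * b"
  obtains t where "x' = x + t * b" "y' = y - t * a"
proof -
  have eq: "(x' - x) * a = (y - y') * b" using assms(3) by (simp add: algebra_simps)
  then have "b dvd (x' - x) * a" by simp
  then have "b dvd x' - x" using assms(1) by (simp add: coprime_dvd_mult_left_iff coprime_commute)
  then obtain t where t: "x' - x = b * t" ..
  then have "(y - y') * b = (t * a) * b" using eq by (simp add: algebra_simps)
  then have "y - y' = t * a" using assms(2) by simp
  with t show ?thesis by (intro that[of t]) (simp_all add: algebra_simps)
qed

lemma coprime_linear_eq_nonnegE:
  fixes a b x y x' y' :: int
  assumes "coprime a b" "0 < b" "x * a + y * b = x' * a + y' * b" "x < x' + b"
  obtains t where "0 \<le> t" "x' = x + t * b" "y' = y - t * a"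
proof -
  obtain t where t: "x' = x + t * b" "y' = y - t * a"
    using coprime_linear_eqE[OF assms(1) _ assms(3)] assms(2) by blast
  have "(- 1) * b < t * b" using t(1) assms(4) by simp
  then have "0 \<le> t" using assms(2) by (simp only: mult_less_cancel_right) linarith
  then show ?thesis using that t by blast
qed

lemma coprime_linear_normal_form:
  fixes a b z :: int
  assumes "coprime a b" "0 < b"
  obtains x y where "z = x * a + y * b" "0 \<le> x" "x < b"
proof -
  obtain u v where "u * a + v * b = 1" using bezout_int[of a b] assms(1) by auto
  then have "z = z * (u * a + v * b)" by simp
  also have "\<dots> = ((z * u) div b * b + (z * u) mod b) * a + z * v * b"
    unfolding div_mult_mod_eq by (simp add: algebra_simps)
  also have "\<dots> = (z * u) mod b * a + (z * v + (z * u) div b * a) * b"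
    by (simp only: algebra_simps)
  finally show ?thesis using that assms(2) by simp
qed

lemma bezout_couple_ex1:
  fixes p q i :: int
  assumes "coprime p q" "0 < p"
  shows "\<exists>!u. case u of (x, y) \<Rightarrow> x * p + y * q = i \<and> 0 < y \<and> y \<le> p"
proof -
  have coprime: "coprime q p" using assms(1) by (simp add: coprime_commute)
  obtain y x where "i - q = y * q + x * p" "0 \<le> y" "y < p"
    using coprime_linear_normal_form[OF coprime assms(2)] .
  then have "case (x, y + 1) of (x, y) \<Rightarrow> x * p + y * q = i \<and> 0 < y \<and> y \<le> p"
    by (simp add: algebra_simps)
  moreover have "u = v"
    if "case u of (x, y) \<Rightarrow> x * p + y * q = i \<and> 0 < y \<and> y \<le> p"
      and "case v of (x, y) \<Rightarrow> x * p + y * q = i \<and> 0 < y \<and> y \<le> p" for u v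
  proof (cases u, cases v)
    fix x y x' y' assume uv: "u = (x, y)" "v = (x', y')"
    with that have bounds: "0 < y" "y \<le> p" "0 < y'" "y' \<le> p"
      and "y * q + x * p = y' * q + x' * p"
      by simp_all
    then obtain t where t: "y' = y + t * p" "x' = x - t * q"
      using coprime_linear_eqE[OF coprime] assms(2) by (metis less_irrefl)
    then have "\<bar>t * p\<bar> < 1 * p" using bounds by simp
    then have "t = 0" using assms(2) by (simp add: abs_mult)
    then show "u = v" using t uv by simp
  qed
  ultimately show ?thesis by blast
qed

lemma lambda_bez_eq_iff:
  assumes "coprime p q" "0 < p"
  shows "lambda_bez p q i = (x, y) \<longleftrightarrow> x * p + y * q = i \<and> 0 < y \<and> y \<le> p"
  using theI'[OF bezout_couple_ex1[OF assms]] the1_equality[OF bezout_couple_ex1[OF assms]]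
  unfolding lambda_bez_def by (metis (mono_tags, lifting) case_prod_conv)

lemma mu_bez_eq_swap:
  assumes "coprime p q" "0 < q"
  shows "mu_bez p q i = prod.swap (lambda_bez q p i)"
proof -
  have coprime: "coprime q p" using assms(1) by (simp add: coprime_commute)
  obtain x y where lambda: "lambda_bez q p i = (x, y)" by fastforce
  have "mu_bez p q i = (y, x)"
    unfolding mu_bez_def
  proof (rule the_equality)
    show "case (y, x) of (x, y) \<Rightarrow> x * p + y * q = i \<and> 0 < x \<and> x \<le> q"
      using lambda unfolding lambda_bez_eq_iff[OF coprime assms(2)] by (simp add: add.commute)
    show "u = (y, x)" if "case u of (x, y) \<Rightarrow> x * p + y * q = i \<and> 0 < x \<and> x \<le> q" for u
    proof (cases u)
      case (Pair v w)
      then have "lambda_bez q p i = (w, v)"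
        using that unfolding lambda_bez_eq_iff[OF coprime assms(2)] by (simp add: add.commute)
      then show ?thesis using lambda Pair by simp
    qed
  qed
  then show ?thesis using lambda by simp
qed

lemma mu_irred_iff_lambda_irred:
  assumes "coprime p q" "0 < q"
  shows "mu_irred p q i \<longleftrightarrow> lambda_irred q p i"
proof -
  have "padd (prod.swap u) (prod.swap v) = prod.swap (padd u v)" for u v
    by (simp add: padd_def)
  moreover have "prod.swap u = prod.swap v \<longleftrightarrow> u = v" for u v :: "int \<times> int"
    by (metis swap_swap)
  ultimately show ?thesis
    by (simp add: mu_irred_def lambda_irred_def mu_bez_eq_swap[OF assms] max.commute)
qed

section \<open>Irreducible couples\<close>

text \<open>The couple (x, y) stands for - x p + y q, so that both kinds of Bezout couples have
  nonnegative entries.\<close>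
definition positive_couple :: "int \<Rightarrow> int \<Rightarrow> int \<Rightarrow> int \<Rightarrow> bool" where
  "positive_couple p q x y \<longleftrightarrow> 0 \<le> x \<and> x * p < y * q"

definition irreducible_couple :: "int \<Rightarrow> int \<Rightarrow> int \<Rightarrow> int \<Rightarrow> bool" where
  "irreducible_couple p q x y \<longleftrightarrow> positive_couple p q x y \<and>
    \<not> (\<exists>x' y'. positive_couple p q x' y' \<and> positive_couple p q (x - x') (y - y'))"

definition irreducible_values :: "int \<Rightarrow> int \<Rightarrow> int set" where
  "irreducible_values p q = {y * q - x * p | x y. irreducible_couple p q x y}"

lemma positive_couple_pos:
  assumes "positive_couple p q x y" "0 < p" "0 < q"
  shows "0 < y"
proof -
  have "0 \<le> x * p" using assms by (simp add: positive_couple_def)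
  then have "0 < y * q" using assms(1) unfolding positive_couple_def by linarith
  then show ?thesis using assms(3) by (simp add: zero_less_mult_iff)
qed

lemma irreducible_values_scale:
  assumes "0 < g"
  shows "irreducible_values (g * p) (g * q) = (*) g ` irreducible_values p q"
proof -
  have "positive_couple (g * p) (g * q) = positive_couple p q"
    using assms by (simp add: positive_couple_def mult.left_commute fun_eq_iff)
  then have "irreducible_couple (g * p) (g * q) = irreducible_couple p q"
    by (simp add: irreducible_couple_def fun_eq_iff)
  then have "irreducible_values (g * p) (g * q)
      = {g * (y * q - x * p) | x y. irreducible_couple p q x y}"
    unfolding irreducible_values_def by (simp add: algebra_simps)
  also have "\<dots> = (*) g ` irreducible_values p q" unfolding irreducible_values_def by blast
  finally show ?thesis .
qed

text \<open>A couple of larger value splits off (0, 1).\<close>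
lemma irreducible_couple_value_le:
  assumes "irreducible_couple p q x y" "0 < q"
  shows "y * q - x * p \<le> q"
proof (rule ccontr)
  assume "\<not> ?thesis"
  then have "positive_couple p q 0 1" "positive_couple p q (x - 0) (y - 1)"
    using assms by (simp_all add: positive_couple_def irreducible_couple_def algebra_simps)
  with assms(1) show False unfolding irreducible_couple_def by blast
qed

lemma irreducible_couple_add_multipleD:
  assumes "irreducible_couple p q (x + t * q) (y + t * p)" "positive_couple p q x y"
    and "0 \<le> t" "0 < q"
  shows "irreducible_couple p q x y"
proof -
  have shift: "positive_couple p q (x' + t * q) (y' + t * p)"
    if "positive_couple p q x' y'" for x' y'
    using that assms(3,4) by (simp add: positive_couple_def algebra_simps)
  have "\<not> positive_couple p q (x - x') (y - y')" if "positive_couple p q x' y'" for x' y'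
    using assms(1) shift[of "x - x'" "y - y'"] that
    unfolding irreducible_couple_def by (metis add_diff_eq add.commute)
  then show ?thesis using assms(2) unfolding irreducible_couple_def by blast
qed

lemma lambda_bez_positive_coupleE:
  assumes "coprime p q" "0 < p" "0 < q" "i \<in> {1..max p q}"
  obtains x y where "lambda_bez p q i = (- x, y)" "positive_couple p q x y" "y * q - x * p = i"
    "y \<le> p"
proof -
  obtain u y where uy: "lambda_bez p q i = (u, y)" by fastforce
  then have i_eq: "u * p + y * q = i" and y: "0 < y" "y \<le> p"
    using lambda_bez_eq_iff assms(1,2) by auto
  have "u \<le> 0"
  proof (rule ccontr)
    assume "\<not> u \<le> 0"
    then have "p \<le> u * p" "q \<le> y * q" using y assms(2,3) by simp_all
    then have "p + q \<le> i" using i_eq by linarith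
    then show False using assms(2-4) by simp
  qed
  then have "positive_couple p q (- u) y"
    using i_eq assms(4) by (simp add: positive_couple_def)
  then show ?thesis using that[of "- u" y] uy i_eq y by simp
qed

lemma lambda_irred_if_irreducible_couple:
  assumes pq: "coprime p q" "0 < p" "0 < q"
    and xy: "lambda_bez p q i = (- x, y)" and irreducible: "irreducible_couple p q x y"
  shows "lambda_irred p q i"
  unfolding lambda_irred_def
proof
  assume "\<exists>j\<in>{1..max p q}. \<exists>k\<in>{1..max p q}.
    lambda_bez p q i = padd (lambda_bez p q j) (lambda_bez p q k)"
  then obtain j k where jk: "j \<in> {1..max p q}" "k \<in> {1..max p q}"
    and sum: "lambda_bez p q i = padd (lambda_bez p q j) (lambda_bez p q k)" by blast
  obtain x1 y1 where j: "lambda_bez p q j = (- x1, y1)" "positive_couple p q x1 y1"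
    using lambda_bez_positive_coupleE[OF pq jk(1)] .
  obtain x2 y2 where k: "lambda_bez p q k = (- x2, y2)" "positive_couple p q x2 y2"
    using lambda_bez_positive_coupleE[OF pq jk(2)] .
  have "x - x1 = x2" "y - y1 = y2" using sum xy j(1) k(1) by (simp_all add: padd_def)
  then show False using irreducible j(2) k(2) unfolding irreducible_couple_def by metis
qed

lemma irreducible_couple_if_lambda_irred:
  assumes pq: "coprime p q" "0 < p" "0 < q" and i: "i \<le> max p q"
    and xy: "lambda_bez p q i = (- x, y)" and positive: "positive_couple p q x y"
    and irred: "lambda_irred p q i"
  shows "irreducible_couple p q x y"
proof -
  have i_eq: "y * q - x * p = i" and "y \<le> p"
    using xy lambda_bez_eq_iff[OF pq(1,2)] by auto
  have "\<not> positive_couple p q (x - x') (y - y')" if x'y': "positive_couple p q x' y'" for x' y'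
  proof
    assume diff: "positive_couple p q (x - x') (y - y')"
    define j k where "j = y' * q - x' * p" and "k = (y - y') * q - (x - x') * p"
    have "0 < j" "0 < k" using x'y' diff by (simp_all add: j_def k_def positive_couple_def)
    moreover have "j + k = i" using i_eq by (simp add: j_def k_def algebra_simps)
    ultimately have "j \<in> {1..max p q}" "k \<in> {1..max p q}" using i by auto
    moreover have "lambda_bez p q j = (- x', y')" "lambda_bez p q k = (x' - x, y - y')"
      using positive_couple_pos[OF x'y'] positive_couple_pos[OF diff] pq \<open>y \<le> p\<close>
      by (auto simp: lambda_bez_eq_iff j_def k_def algebra_simps)
    then have "lambda_bez p q i = padd (lambda_bez p q j) (lambda_bez p q k)"
      using xy by (simp add: padd_def)
    ultimately show False using irred unfolding lambda_irred_def by blast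
  qed
  with positive show ?thesis unfolding irreducible_couple_def by blast
qed

text \<open>An irreducible couple differs from the normalised one by a multiple of the couple (q, p) of
  value 0.\<close>
lemma irreducible_values_eq_lambda_irred:
  assumes pq: "coprime p q" "0 < p" "0 < q"
  shows "irreducible_values p q = {i \<in> {1..max p q}. lambda_irred p q i}"
proof (intro equalityI subsetI)
  fix i assume "i \<in> irreducible_values p q"
  then obtain x y where xy: "irreducible_couple p q x y" and i: "i = y * q - x * p"
    unfolding irreducible_values_def by blast
  have positive: "positive_couple p q x y" using xy unfolding irreducible_couple_def by blast
  then have "1 \<le> i" by (simp add: i positive_couple_def)
  moreover have "i \<le> q" using irreducible_couple_value_le[OF xy pq(3)] by (simp add: i)
  ultimately have range: "i \<in> {1..max p q}" by simp
  obtain x0 y0 where x0y0: "lambda_bez p q i = (- x0, y0)" "positive_couple p q x0 y0"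
      "y0 * q - x0 * p = i" "y0 \<le> p"
    using lambda_bez_positive_coupleE[OF pq range] .
  have "coprime q p" using pq(1) by (simp add: coprime_commute)
  moreover have "y0 * q + (- x0) * p = y * q + (- x) * p" using i x0y0(3) by simp
  moreover have "y0 < y + p" using positive_couple_pos[OF positive pq(2,3)] x0y0(4) by simp
  ultimately obtain t where t: "0 \<le> t" "y = y0 + t * p" "- x = - x0 - t * q"
    using coprime_linear_eq_nonnegE pq(2) by blast
  then have "x = x0 + t * q" by simp
  then have "irreducible_couple p q x0 y0"
    using irreducible_couple_add_multipleD[OF _ x0y0(2) t(1) pq(3)] xy t(2) by simp
  then have "lambda_irred p q i"
    using lambda_irred_if_irreducible_couple[OF pq x0y0(1)] by blast
  with range show "i \<in> {i \<in> {1..max p q}. lambda_irred p q i}" by simp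
next
  fix i assume "i \<in> {i \<in> {1..max p q}. lambda_irred p q i}"
  then have range: "i \<in> {1..max p q}" and irred: "lambda_irred p q i" by simp_all
  obtain x y where xy: "lambda_bez p q i = (- x, y)" "positive_couple p q x y"
      and i: "y * q - x * p = i"
    using lambda_bez_positive_coupleE[OF pq range] .
  have "irreducible_couple p q x y"
    using irreducible_couple_if_lambda_irred[OF pq _ xy irred] range by simp
  then show "i \<in> irreducible_values p q" using i unfolding irreducible_values_def by blast
qed

lemma irreducible_values_eq_mu_irred:
  assumes "coprime p q" "0 < p" "0 < q"
  shows "irreducible_values q p = {i \<in> {1..max p q}. mu_irred p q i}"
  using irreducible_values_eq_lambda_irred[of q p] assms
  by (simp add: mu_irred_iff_lambda_irred coprime_commute max.commute)

section \<open>Relations and the delta set\<close>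

definition relation :: "nat \<Rightarrow> nat \<Rightarrow> nat \<Rightarrow> int \<Rightarrow> int \<Rightarrow> int \<Rightarrow> bool" where
  "relation n1 n2 n3 z1 z2 z3 \<longleftrightarrow> z1 * int n1 + z2 * int n2 + z3 * int n3 = 0"

text \<open>The lower bounds min 0 z are those imposed by the smallest pair of factorizations with
  difference z: larger pairs only leave room for more intermediate lengths.\<close>
definition gap_relation :: "nat \<Rightarrow> nat \<Rightarrow> nat \<Rightarrow> int \<Rightarrow> int \<Rightarrow> int \<Rightarrow> bool" where
  "gap_relation n1 n2 n3 z1 z2 z3 \<longleftrightarrow> relation n1 n2 n3 z1 z2 z3 \<and> 0 < z1 + z2 + z3 \<and>
    \<not> (\<exists>w1 w2 w3. relation n1 n2 n3 w1 w2 w3 \<and>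
      0 < w1 + w2 + w3 \<and> w1 + w2 + w3 < z1 + z2 + z3 \<and>
      min 0 z1 \<le> w1 \<and> min 0 z2 \<le> w2 \<and> min 0 z3 \<le> w3)"

lemma mem_lengths_iff_relation:
  "m \<in> lengths n1 n2 n3 (x1 * n1 + x2 * n2 + x3 * n3) \<longleftrightarrow>
    (\<exists>w1 w2 w3. relation n1 n2 n3 w1 w2 w3 \<and> - int x1 \<le> w1 \<and> - int x2 \<le> w2 \<and> - int x3 \<le> w3 \<and>
      int m = int (x1 + x2 + x3) + (w1 + w2 + w3))" (is "_ \<longleftrightarrow> ?R")
proof
  assume "m \<in> lengths n1 n2 n3 (x1 * n1 + x2 * n2 + x3 * n3)"
  then obtain y1 y2 y3 where m: "m = y1 + y2 + y3"
    and "y1 * n1 + y2 * n2 + y3 * n3 = x1 * n1 + x2 * n2 + x3 * n3"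
    unfolding lengths_def by blast
  then have "int (y1 * n1 + y2 * n2 + y3 * n3) = int (x1 * n1 + x2 * n2 + x3 * n3)" by simp
  then have "relation n1 n2 n3 (int y1 - int x1) (int y2 - int x2) (int y3 - int x3)"
    by (simp add: relation_def algebra_simps)
  moreover have "int m = int (x1 + x2 + x3)
      + ((int y1 - int x1) + (int y2 - int x2) + (int y3 - int x3))"
    by (simp add: m)
  ultimately show ?R by fastforce
next
  assume ?R
  then obtain w1 w2 w3 where w: "relation n1 n2 n3 w1 w2 w3"
      "- int x1 \<le> w1" "- int x2 \<le> w2" "- int x3 \<le> w3"
    and m: "int m = int (x1 + x2 + x3) + (w1 + w2 + w3)" by blast
  define y1 y2 y3 where "y1 = nat (int x1 + w1)" "y2 = nat (int x2 + w2)" "y3 = nat (int x3 + w3)"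
  then have y: "int y1 = int x1 + w1" "int y2 = int x2 + w2" "int y3 = int x3 + w3"
    using w by simp_all
  have "int (y1 * n1 + y2 * n2 + y3 * n3) = int (x1 * n1 + x2 * n2 + x3 * n3)"
    using w(1) by (simp add: y relation_def algebra_simps)
  then have "y1 * n1 + y2 * n2 + y3 * n3 = x1 * n1 + x2 * n2 + x3 * n3"
    by (simp only: of_nat_eq_iff)
  moreover have "int m = int (y1 + y2 + y3)" using m by (simp add: y)
  then have "m = y1 + y2 + y3" by (simp only: of_nat_eq_iff)
  ultimately show "m \<in> lengths n1 n2 n3 (x1 * n1 + x2 * n2 + x3 * n3)"
    unfolding lengths_def by blast
qed

lemma gap_relation_if_mem_delta_set:
  assumes "d \<in> delta_set n1 n2 n3"
  obtains z1 z2 z3 where "gap_relation n1 n2 n3 z1 z2 z3" "d = z1 + z2 + z3"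
proof -
  obtain s l m where d: "d = int m - int l" "l < m"
    and lm: "l \<in> lengths n1 n2 n3 s" "m \<in> lengths n1 n2 n3 s"
    and consecutive: "\<not> (\<exists>k\<in>lengths n1 n2 n3 s. l < k \<and> k < m)"
    using assms unfolding delta_set_def delta_elem_def by blast
  obtain x1 x2 x3 where l: "l = x1 + x2 + x3" and s: "s = x1 * n1 + x2 * n2 + x3 * n3"
    using lm(1) unfolding lengths_def by blast
  obtain z1 z2 z3 where z: "relation n1 n2 n3 z1 z2 z3"
      "- int x1 \<le> z1" "- int x2 \<le> z2" "- int x3 \<le> z3"
    and m: "int m = int l + (z1 + z2 + z3)"
    using lm(2) unfolding s mem_lengths_iff_relation l by blast
  have "\<not> (min 0 z1 \<le> w1 \<and> min 0 z2 \<le> w2 \<and> min 0 z3 \<le> w3)"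
    if w: "relation n1 n2 n3 w1 w2 w3" "0 < w1 + w2 + w3" "w1 + w2 + w3 < z1 + z2 + z3"
    for w1 w2 w3
  proof
    assume "min 0 z1 \<le> w1 \<and> min 0 z2 \<le> w2 \<and> min 0 z3 \<le> w3"
    then have "- int x1 \<le> w1" "- int x2 \<le> w2" "- int x3 \<le> w3" using z by auto
    moreover define k where "k = nat (int l + (w1 + w2 + w3))"
    then have k: "int k = int l + (w1 + w2 + w3)" using w(2) by simp
    ultimately have "k \<in> lengths n1 n2 n3 s"
      unfolding s mem_lengths_iff_relation using w(1) l by blast
    moreover have "l < k" "k < m" using w(2,3) k m by simp_all
    ultimately show False using consecutive by blast
  qed
  then have "gap_relation n1 n2 n3 z1 z2 z3"
    unfolding gap_relation_def using z(1) m d(2) by auto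
  then show ?thesis using that m d(1) by simp
qed

lemma mem_delta_set_if_gap_relation:
  assumes "gap_relation n1 n2 n3 z1 z2 z3"
  shows "z1 + z2 + z3 \<in> delta_set n1 n2 n3"
proof -
  have z: "relation n1 n2 n3 z1 z2 z3" "0 < z1 + z2 + z3"
    using assms unfolding gap_relation_def by simp_all
  define x1 x2 x3 where "x1 = nat (- min 0 z1)" "x2 = nat (- min 0 z2)" "x3 = nat (- min 0 z3)"
  then have x: "- int x1 = min 0 z1" "- int x2 = min 0 z2" "- int x3 = min 0 z3" by simp_all
  define L where "L = lengths n1 n2 n3 (x1 * n1 + x2 * n2 + x3 * n3)"
  define l where "l = x1 + x2 + x3"
  have mem_iff: "m \<in> L \<longleftrightarrow> (\<exists>w1 w2 w3. relation n1 n2 n3 w1 w2 w3 \<and>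
      min 0 z1 \<le> w1 \<and> min 0 z2 \<le> w2 \<and> min 0 z3 \<le> w3 \<and> int m = int l + (w1 + w2 + w3))" for m
    unfolding L_def l_def mem_lengths_iff_relation x by simp
  define m where "m = nat (int l + (z1 + z2 + z3))"
  then have m: "int m = int l + (z1 + z2 + z3)" using z(2) by simp
  then have "m \<in> L" unfolding mem_iff using z(1) by force
  moreover have "l \<in> L" unfolding L_def l_def lengths_def by blast
  moreover have "\<not> (\<exists>k\<in>L. l < k \<and> k < m)"
  proof
    assume "\<exists>k\<in>L. l < k \<and> k < m"
    then obtain k w1 w2 w3 where "l < k" "k < m" and w: "relation n1 n2 n3 w1 w2 w3"
        "min 0 z1 \<le> w1" "min 0 z2 \<le> w2" "min 0 z3 \<le> w3" and k: "int k = int l + (w1 + w2 + w3)"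
      by (auto simp: mem_iff)
    then have "0 < w1 + w2 + w3" "w1 + w2 + w3 < z1 + z2 + z3" using m by linarith+
    with w show False using assms unfolding gap_relation_def by blast
  qed
  moreover have "z1 + z2 + z3 = int m - int l" "l < m" using m z(2) by simp_all
  ultimately have "z1 + z2 + z3 \<in> delta_elem L" unfolding delta_elem_def by blast
  then show ?thesis unfolding delta_set_def L_def sg3_def by blast
qed

section \<open>Gaps in a lattice of rank two\<close>

text \<open>The coordinates of a v1 + b v3, where v1 = (c1, - r12, - r13) and v3 = (- r31, - r32, c3).\<close>
locale vector_pair =
  fixes c1 r12 r13 r31 r32 c3 :: int
begin

definition coord1 :: "int \<Rightarrow> int \<Rightarrow> int" where "coord1 a b = a * c1 - b * r31"
definition coord2 :: "int \<Rightarrow> int \<Rightarrow> int" where "coord2 a b = - a * r12 - b * r32"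
definition coord3 :: "int \<Rightarrow> int \<Rightarrow> int" where "coord3 a b = b * c3 - a * r13"

lemmas coord_defs = coord1_def coord2_def coord3_def

end

locale signed_vector_pair = vector_pair +
  assumes r_pos: "0 < r12" "0 < r13" "0 < r31" "0 < r32"
    and r_less: "r31 < c1" "r13 < c3"

text \<open>The lengths of v1 and v3 are \<delta>1 and - \<delta>3.\<close>
locale measured_vector_pair = signed_vector_pair +
  fixes \<delta>1 \<delta>3 :: int
  assumes \<delta>_pos: "0 < \<delta>1" "0 < \<delta>3"
    and slope: "\<delta>1 * r31 < \<delta>3 * c1" "\<delta>3 * r13 < \<delta>1 * c3"
begin

definition len :: "int \<Rightarrow> int \<Rightarrow> int" where "len a b = a * \<delta>1 - b * \<delta>3"

definition intermediate :: "int \<Rightarrow> int \<Rightarrow> int \<Rightarrow> int \<Rightarrow> bool" where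
  "intermediate a b a' b' \<longleftrightarrow> 0 < len a' b' \<and> len a' b' < len a b \<and>
    min 0 (coord1 a b) \<le> coord1 a' b' \<and> min 0 (coord2 a b) \<le> coord2 a' b' \<and>
    min 0 (coord3 a b) \<le> coord3 a' b'"

definition gap :: "int \<Rightarrow> int \<Rightarrow> bool" where
  "gap a b \<longleftrightarrow> 0 < len a b \<and> \<not> (\<exists>a' b'. intermediate a b a' b')"

lemma coord_diffs:
  "len (a - a') (b - b') = len a b - len a' b'"
  "coord1 (a - a') (b - b') = coord1 a b - coord1 a' b'"
  "coord2 (a - a') (b - b') = coord2 a b - coord2 a' b'"
  "coord3 (a - a') (b - b') = coord3 a b - coord3 a' b'"
  by (simp_all add: coord_defs len_def algebra_simps)

lemma positive_couple_iff_len: "positive_couple \<delta>3 \<delta>1 b a \<longleftrightarrow> 0 \<le> b \<and> 0 < len a b"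
  by (simp add: positive_couple_def len_def)

lemma coord1_pos:
  assumes "0 \<le> b" "0 < len a b"
  shows "0 < coord1 a b"
proof -
  have "0 < c1" using r_less r_pos by simp
  then have "0 < len a b * c1" using assms by simp
  moreover have "b * (\<delta>1 * r31) \<le> b * (\<delta>3 * c1)"
    using assms slope by (intro mult_left_mono) auto
  ultimately have "0 < \<delta>1 * coord1 a b" by (simp add: coord1_def len_def algebra_simps)
  then show ?thesis using \<delta>_pos by (simp add: zero_less_mult_iff)
qed

lemma pos_if_len_pos:
  assumes "0 \<le> b" "0 < len a b"
  shows "0 < a"
proof -
  have "0 \<le> b * \<delta>3" using assms \<delta>_pos by simp
  then have "0 < a * \<delta>1" using assms(2) unfolding len_def by linarith
  then show ?thesis using \<delta>_pos by (simp add: zero_less_mult_iff)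
qed

lemma coord2_nonpos:
  assumes "0 \<le> a" "0 \<le> b"
  shows "coord2 a b \<le> 0"
proof -
  have "0 \<le> a * r12" "0 \<le> b * r32" using assms r_pos by simp_all
  then show ?thesis by (simp add: coord2_def)
qed

lemma coord2_pos:
  assumes "a \<le> 0" "b < 0"
  shows "0 < coord2 a b"
proof -
  have "a * r12 \<le> 0" "b * r32 < 0"
    using assms r_pos by (simp_all add: mult_le_0_iff mult_less_0_iff)
  then show ?thesis by (simp add: coord2_def)
qed

text \<open>If two couples add up to (a, b), then one of them has the larger third coordinate required of
  an intermediate vector.\<close>
lemma irreducible_couple_if_gap:
  assumes "gap a b" "0 \<le> b"
  shows "irreducible_couple \<delta>3 \<delta>1 b a"
proof -
  have "\<not> (positive_couple \<delta>3 \<delta>1 b' a' \<and> positive_couple \<delta>3 \<delta>1 (b - b') (a - a'))" for a' b'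
  proof
    assume "positive_couple \<delta>3 \<delta>1 b' a' \<and> positive_couple \<delta>3 \<delta>1 (b - b') (a - a')"
    then have pos: "0 \<le> b'" "0 < len a' b'" "0 \<le> b - b'" "0 < len (a - a') (b - b')"
      by (simp_all add: positive_couple_iff_len)
    then have "0 < a'" "0 < a - a'" by (blast intro: pos_if_len_pos)+
    then have "coord2 a' b' \<le> 0" "coord2 (a - a') (b - b') \<le> 0"
      using pos coord2_nonpos by simp_all
    moreover have "0 < coord1 a' b'" "0 < coord1 (a - a') (b - b')"
      using pos by (simp_all add: coord1_pos)
    ultimately have "intermediate a b a' b' \<or> intermediate a b (a - a') (b - b')"
      using pos unfolding intermediate_def coord_diffs by linarith
    then show False using assms(1) unfolding gap_def by blast
  qed
  then show ?thesis
    using assms unfolding irreducible_couple_def gap_def positive_couple_iff_len by blast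
qed

lemma nonpos_if_short:
  assumes "len a b < \<delta>1" "b < 0"
  shows "a \<le> 0"
proof (rule ccontr)
  assume "\<not> a \<le> 0"
  then have "\<delta>1 \<le> a * \<delta>1" "b * \<delta>3 < 0" using assms(2) \<delta>_pos by (simp_all add: mult_less_0_iff)
  then show False using assms(1) by (simp add: len_def)
qed

lemma len_le_if_irreducible_couple:
  assumes "irreducible_couple \<delta>3 \<delta>1 b a"
  shows "len a b \<le> \<delta>1"
  using irreducible_couple_value_le[OF assms \<delta>_pos(1)] by (simp add: len_def)

lemma less_if_coord1_nonneg:
  assumes "0 \<le> coord1 a b" "b < 0"
  shows "b < a"
proof (rule ccontr)
  assume "\<not> b < a"
  then have "a * c1 \<le> b * c1" using r_less r_pos by simp
  moreover have "b * c1 < b * r31" using assms(2) r_less by simp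
  ultimately show False using assms(1) by (simp add: coord1_def)
qed

lemma coord3_gt_if_short:
  assumes "0 \<le> b" "len a b \<le> \<delta>1" "\<delta>3 \<le> \<delta>1"
  shows "- c3 < coord3 a b"
proof -
  have "b * \<delta>3 \<le> b * \<delta>1" using assms by (intro mult_left_mono)
  then have "(a - b - 1) * \<delta>1 \<le> 0" using assms(2) by (simp add: len_def algebra_simps)
  then have "a \<le> b + 1" using \<delta>_pos by (simp add: mult_le_0_iff)
  then have "a * r13 \<le> (b + 1) * r13" using r_pos by simp
  moreover have "b * r13 \<le> b * c3" using assms(1) r_less by (intro mult_left_mono) auto
  ultimately show ?thesis using r_less by (simp add: coord3_def algebra_simps)
qed

text \<open>An intermediate vector with b' < 0 has b' < a' \<le> 0; it is too long if \<delta>1 < \<delta>3, and its third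
  coordinate is at most - c3 otherwise.\<close>
lemma intermediate_nonneg:
  assumes irr: "irreducible_couple \<delta>3 \<delta>1 b a" and w: "intermediate a b a' b'"
  shows "0 \<le> b'"
proof (rule ccontr)
  assume "\<not> 0 \<le> b'"
  then have b': "b' < 0" by simp
  have ab: "0 \<le> b" "0 < len a b"
    using irr by (simp_all add: irreducible_couple_def positive_couple_iff_len)
  have le: "len a b \<le> \<delta>1" using len_le_if_irreducible_couple[OF irr] .
  have short: "len a' b' < \<delta>1" using w le by (simp add: intermediate_def)
  have a': "a' \<le> 0" using nonpos_if_short[OF short b'] .
  have "0 \<le> coord1 a' b'" using w coord1_pos[OF ab] by (simp add: intermediate_def)
  then have "b' < a'" using less_if_coord1_nonneg b' by blast
  show False
  proof (cases "\<delta>1 < \<delta>3")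
    case True
    then have "a' * \<delta>3 \<le> a' * \<delta>1" using a' by (intro mult_left_mono_neg) auto
    moreover have "\<delta>3 \<le> (a' - b') * \<delta>3" using \<open>b' < a'\<close> \<delta>_pos by simp
    ultimately show False using short True by (simp add: len_def algebra_simps)
  next
    case False
    then have "- c3 < coord3 a b" using coord3_gt_if_short ab(1) le by simp
    then have "- c3 < coord3 a' b'"
      using w r_pos r_less by (auto simp: intermediate_def min_def split: if_splits)
    moreover have "b' * c3 \<le> (a' - 1) * c3" using \<open>b' < a'\<close> r_pos r_less by simp
    moreover have "a' * c3 \<le> a' * r13" using a' r_less by (intro mult_left_mono_neg) auto
    ultimately show False by (simp add: coord3_def algebra_simps)
  qed
qed

lemma gap_if_irreducible_couple:
  assumes irr: "irreducible_couple \<delta>3 \<delta>1 b a"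
  shows "gap a b"
proof -
  have ab: "0 \<le> b" "0 < len a b"
    using irr by (simp_all add: irreducible_couple_def positive_couple_iff_len)
  have False if w: "intermediate a b a' b'" for a' b'
  proof -
    have len: "0 < len a' b'" "0 < len (a - a') (b - b')" "len (a - a') (b - b') < \<delta>1"
      using w len_le_if_irreducible_couple[OF irr] by (simp_all add: intermediate_def coord_diffs)
    have "coord2 a b \<le> 0" using coord2_nonpos pos_if_len_pos[OF ab] ab(1) by simp
    then have coord2: "coord2 (a - a') (b - b') \<le> 0"
      using w by (simp add: intermediate_def coord_diffs)
    have "0 \<le> b - b'"
    proof (rule ccontr)
      assume "\<not> 0 \<le> b - b'"
      then have neg: "b - b' < 0" by simp
      show False using coord2_pos[OF nonpos_if_short[OF len(3) neg] neg] coord2 by simp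
    qed
    moreover have "0 \<le> b'" using intermediate_nonneg[OF irr w] .
    ultimately show False
      using irr len unfolding irreducible_couple_def positive_couple_iff_len by blast
  qed
  with ab show ?thesis unfolding gap_def by blast
qed

lemma not_gap_if_opposite:
  assumes "0 < a" "b < 0"
  shows "\<not> gap a b"
proof -
  have "0 < a * \<delta>1" "0 \<le> a * r13" using assms \<delta>_pos r_pos by simp_all
  moreover have "1 * \<delta>3 \<le> (- b) * \<delta>3" "1 * c3 \<le> (- b) * c3"
    using assms \<delta>_pos r_pos r_less by (intro mult_right_mono; simp)+
  ultimately have "intermediate a b 0 (- 1)"
    using \<delta>_pos r_pos by (auto simp: intermediate_def coord_defs len_def)
  then show ?thesis unfolding gap_def by blast
qed

lemma measured_vector_pair_swap: "measured_vector_pair c3 r32 r31 r13 r12 c1 \<delta>3 \<delta>1"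
  by unfold_locales (fact r_pos r_less \<delta>_pos slope)+

text \<open>Replacing an intermediate vector w of z by z - w shows that z is a gap for a length function
  iff - z is a gap for its negative; this exchanges the roles of v1 and v3.\<close>
lemma gap_swap: "measured_vector_pair.gap c3 r32 r31 r13 r12 c1 \<delta>3 \<delta>1 (- b) (- a) \<longleftrightarrow> gap a b"
proof -
  interpret swap: measured_vector_pair c3 r32 r31 r13 r12 c1 \<delta>3 \<delta>1
    by (fact measured_vector_pair_swap)
  have coords: "swap.len u v = len (- v) (- u)" "swap.coord1 u v = - coord3 (- v) (- u)"
    "swap.coord2 u v = - coord2 (- v) (- u)" "swap.coord3 u v = - coord1 (- v) (- u)" for u v
    by (simp_all add: coord_defs swap.coord_defs len_def swap.len_def)
  have complement: "swap.intermediate (- b) (- a) u v \<longleftrightarrow> intermediate a b (a + v) (b + u)"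
    for u v
    using coord_diffs[of a "- v" b "- u"]
    by (auto simp: intermediate_def swap.intermediate_def coords)
  have "(\<exists>u v. swap.intermediate (- b) (- a) u v) \<longleftrightarrow> (\<exists>a' b'. intermediate a b a' b')"
  proof
    assume "\<exists>a' b'. intermediate a b a' b'"
    then obtain a' b' where "intermediate a b a' b'" by blast
    then have "swap.intermediate (- b) (- a) (b' - b) (a' - a)" unfolding complement by simp
    then show "\<exists>u v. swap.intermediate (- b) (- a) u v" by blast
  qed (auto simp: complement)
  then show ?thesis unfolding gap_def swap.gap_def coords by simp
qed

lemma gap_iff_irreducible_couple:
  "gap a b \<longleftrightarrow> irreducible_couple \<delta>3 \<delta>1 b a \<or> irreducible_couple \<delta>1 \<delta>3 (- a) (- b)"
proof -
  interpret swap: measured_vector_pair c3 r32 r31 r13 r12 c1 \<delta>3 \<delta>1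
    by (fact measured_vector_pair_swap)
  have "0 \<le> b \<or> 0 \<le> - a" if "gap a b" using not_gap_if_opposite[of a b] that by linarith
  moreover have "gap a b \<longleftrightarrow> irreducible_couple \<delta>3 \<delta>1 b a" if "0 \<le> b"
    using irreducible_couple_if_gap[of a b] gap_if_irreducible_couple[of b a] that by blast
  moreover have "gap a b \<longleftrightarrow> irreducible_couple \<delta>1 \<delta>3 (- a) (- b)" if "0 \<le> - a"
    using swap.irreducible_couple_if_gap[of "- b" "- a"]
      swap.gap_if_irreducible_couple[of "- a" "- b"] that
    unfolding gap_swap by blast
  moreover have "irreducible_couple \<delta>3 \<delta>1 b a \<Longrightarrow> 0 \<le> b"
    "irreducible_couple \<delta>1 \<delta>3 (- a) (- b) \<Longrightarrow> 0 \<le> - a"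
    by (simp_all add: irreducible_couple_def positive_couple_def)
  ultimately show ?thesis by blast
qed

lemma gap_lengths:
  "{len a b | a b. gap a b} = irreducible_values \<delta>1 \<delta>3 \<union> irreducible_values \<delta>3 \<delta>1"
  (is "?L = ?R")
proof (intro equalityI subsetI)
  fix d assume "d \<in> ?L"
  then obtain a b where "d = len a b" "gap a b" by blast
  then show "d \<in> ?R"
  proof (unfold gap_iff_irreducible_couple, elim disjE)
    assume "d = len a b" "irreducible_couple \<delta>3 \<delta>1 b a"
    then show ?thesis unfolding irreducible_values_def len_def by blast
  next
    assume "d = len a b" "irreducible_couple \<delta>1 \<delta>3 (- a) (- b)"
    moreover have "len a b = (- b) * \<delta>3 - (- a) * \<delta>1" by (simp add: len_def)
    ultimately show ?thesis unfolding irreducible_values_def by blast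
  qed
next
  fix d assume "d \<in> ?R"
  then consider (mu) x y where "d = len x y" "irreducible_couple \<delta>3 \<delta>1 y x"
    | (lambda) x y where "d = len (- x) (- y)" "irreducible_couple \<delta>1 \<delta>3 x y"
    unfolding irreducible_values_def by (auto simp: len_def)
  then show "d \<in> ?L"
  proof cases
    case mu
    then have "gap x y" by (simp add: gap_iff_irreducible_couple)
    with mu show ?thesis by blast
  next
    case lambda
    then have "gap (- x) (- y)" by (simp add: gap_iff_irreducible_couple)
    with lambda show ?thesis by blast
  qed
qed

end

section \<open>Symmetric semigroups\<close>

lemma int_sg2_iff:
  "z \<in> int ` sg2 a b \<longleftrightarrow> (\<exists>x\<ge>0. \<exists>y\<ge>0. z = x * int a + y * int b)"
proof
  assume "z \<in> int ` sg2 a b"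
  then obtain x y where "z = int x * int a + int y * int b" unfolding sg2_def by auto
  then show "\<exists>x\<ge>0. \<exists>y\<ge>0. z = x * int a + y * int b" using of_nat_0_le_iff by blast
next
  assume "\<exists>x\<ge>0. \<exists>y\<ge>0. z = x * int a + y * int b"
  then obtain x y where "0 \<le> x" "0 \<le> y" "z = x * int a + y * int b" by blast
  then have "z = int (nat x * a + nat y * b)" by simp
  then show "z \<in> int ` sg2 a b" unfolding sg2_def by blast
qed

lemma int_sg3_iff:
  "z \<in> int ` sg3 a b c \<longleftrightarrow> (\<exists>x\<ge>0. \<exists>y\<ge>0. \<exists>u\<ge>0. z = x * int a + y * int b + u * int c)"
proof
  assume "z \<in> int ` sg3 a b c"
  then obtain x y u where "z = int x * int a + int y * int b + int u * int c"
    unfolding sg3_def by auto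
  then show "\<exists>x\<ge>0. \<exists>y\<ge>0. \<exists>u\<ge>0. z = x * int a + y * int b + u * int c"
    using of_nat_0_le_iff by blast
next
  assume "\<exists>x\<ge>0. \<exists>y\<ge>0. \<exists>u\<ge>0. z = x * int a + y * int b + u * int c"
  then obtain x y u where "0 \<le> x" "0 \<le> y" "0 \<le> u" "z = x * int a + y * int b + u * int c" by blast
  then have "z = int (nat x * a + nat y * b + nat u * c)" by simp
  then show "z \<in> int ` sg3 a b c" unfolding sg3_def by blast
qed

lemma symmetric_sg_if_reflection:
  assumes "0 \<in> S" and refl: "\<And>z. z \<in> int ` S \<longleftrightarrow> F - z \<notin> int ` S"
  shows "symmetric_sg S"
proof -
  have "frobenius S = F"
    unfolding frobenius_def
  proof (rule Greatest_equality)
    show "F \<notin> int ` S" using refl[of 0] assms(1) by force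
    show "z \<le> F" if "z \<notin> int ` S" for z
    proof -
      have "F - z \<in> int ` S" using refl[of z] that by simp
      then show ?thesis by auto
    qed
  qed
  then show ?thesis unfolding symmetric_sg_def by (metis refl)
qed

lemma int_sg2_normal_form_iff:
  assumes "coprime a b" "0 < b" "0 \<le> x" "x < int b"
  shows "x * int a + y * int b \<in> int ` sg2 a b \<longleftrightarrow> 0 \<le> y"
proof
  assume "x * int a + y * int b \<in> int ` sg2 a b"
  then obtain u v where uv: "0 \<le> u" "0 \<le> v" "x * int a + y * int b = u * int a + v * int b"
    unfolding int_sg2_iff by blast
  have "coprime (int a) (int b)" "0 < int b" "x < u + int b" using assms uv(1) by simp_all
  then obtain t where "0 \<le> t" "v = y - t * int a"
    using coprime_linear_eq_nonnegE uv(3) by blast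
  moreover have "0 \<le> t * int a" using \<open>0 \<le> t\<close> by simp
  ultimately show "0 \<le> y" using uv(2) by linarith
next
  assume "0 \<le> y"
  then show "x * int a + y * int b \<in> int ` sg2 a b" unfolding int_sg2_iff using assms(3) by blast
qed

lemma int_sg2_reflection:
  assumes "coprime a b" "0 < b"
  shows "z \<in> int ` sg2 a b \<longleftrightarrow> int a * int b - int a - int b - z \<notin> int ` sg2 a b"
proof -
  obtain x y where z: "z = x * int a + y * int b" "0 \<le> x" "x < int b"
    using coprime_linear_normal_form[of "int a" "int b" z] assms by auto
  have "int a * int b - int a - int b - z = (int b - 1 - x) * int a + (- 1 - y) * int b"
    unfolding z(1) by (simp add: algebra_simps)
  moreover have "(int b - 1 - x) * int a + (- 1 - y) * int b \<in> int ` sg2 a b \<longleftrightarrow> 0 \<le> - 1 - y"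
    using z assms by (intro int_sg2_normal_form_iff) auto
  moreover have "z \<in> int ` sg2 a b \<longleftrightarrow> 0 \<le> y"
    unfolding z(1) using z assms by (intro int_sg2_normal_form_iff) auto
  ultimately show ?thesis by auto
qed

lemma int_sg3_gluing_iff:
  assumes "coprime m d" "0 < d" "m \<in> sg2 a b" "0 \<le> w" "w < int d"
  shows "w * int m + t * int d \<in> int ` sg3 (d * a) (d * b) m \<longleftrightarrow> t \<in> int ` sg2 a b"
proof
  assume "w * int m + t * int d \<in> int ` sg3 (d * a) (d * b) m"
  then obtain x y u where "w * int m + t * int d = x * int (d * a) + y * int (d * b) + u * int m"
    and nonneg: "0 \<le> x" "0 \<le> y" "0 \<le> u"
    unfolding int_sg3_iff by blast
  then have "w * int m + t * int d = u * int m + (x * int a + y * int b) * int d"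
    by (simp add: algebra_simps)
  moreover have "coprime (int m) (int d)" "0 < int d" "w < u + int d"
    using assms nonneg by simp_all
  ultimately obtain e where "0 \<le> e" and e: "x * int a + y * int b = t - e * int m"
    using coprime_linear_eq_nonnegE by blast
  obtain m1 m2 where "0 \<le> m1" "0 \<le> m2" "int m = m1 * int a + m2 * int b"
    using assms(3) int_sg2_iff[of "int m" a b] by auto
  then have "0 \<le> x + e * m1" "0 \<le> y + e * m2" "t = (x + e * m1) * int a + (y + e * m2) * int b"
    using e nonneg \<open>0 \<le> e\<close> by (simp_all add: algebra_simps)
  then show "t \<in> int ` sg2 a b" unfolding int_sg2_iff by blast
next
  assume "t \<in> int ` sg2 a b"
  then obtain x y where "t = x * int a + y * int b" "0 \<le> x" "0 \<le> y"
    unfolding int_sg2_iff by blast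
  then have "w * int m + t * int d = x * int (d * a) + y * int (d * b) + w * int m"
    by (simp add: algebra_simps)
  then show "w * int m + t * int d \<in> int ` sg3 (d * a) (d * b) m"
    unfolding int_sg3_iff using \<open>0 \<le> x\<close> \<open>0 \<le> y\<close> assms(4) by blast
qed

lemma symmetric_sg_gluing:
  assumes "coprime a b" "coprime m d" "0 < b" "0 < d" and m: "m \<in> sg2 a b"
  shows "symmetric_sg (sg3 (d * a) (d * b) m)"
proof -
  let ?S = "sg3 (d * a) (d * b) m"
  define F where "F = int a * int b - int a - int b"
  define G where "G = (int d - 1) * int m + F * int d"
  show ?thesis
  proof (rule symmetric_sg_if_reflection[where F = G])
    show "0 \<in> ?S" unfolding sg3_def by force
    show "z \<in> int ` ?S \<longleftrightarrow> G - z \<notin> int ` ?S" for z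
    proof -
      obtain w t where z: "z = w * int m + t * int d" "0 \<le> w" "w < int d"
        using coprime_linear_normal_form[of "int m" "int d" z] assms by auto
      have "G - z = (int d - 1 - w) * int m + (F - t) * int d"
        unfolding G_def z(1) by (simp add: algebra_simps)
      then have "G - z \<in> int ` ?S \<longleftrightarrow> F - t \<in> int ` sg2 a b"
        using int_sg3_gluing_iff[OF assms(2,4) m] z by simp
      moreover have "z \<in> int ` ?S \<longleftrightarrow> t \<in> int ` sg2 a b"
        unfolding z(1) using int_sg3_gluing_iff[OF assms(2,4) m] z by simp
      moreover have "t \<in> int ` sg2 a b \<longleftrightarrow> F - t \<notin> int ` sg2 a b"
        unfolding F_def using int_sg2_reflection[OF assms(1,3)] .
      ultimately show ?thesis by simp
    qed
  qed
qed

section \<open>Minimal multiples\<close>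

lemma relation_swap12: "relation a b c x y z \<longleftrightarrow> relation b a c y x z"
  by (simp add: relation_def add.commute)

lemma relation_swap23: "relation a b c x y z \<longleftrightarrow> relation a c b x z y"
  by (simp add: relation_def algebra_simps)

lemma relation_diff:
  "relation a b c x y z \<Longrightarrow> relation a b c x' y' z' \<Longrightarrow> relation a b c (x - x') (y - y') (z - z')"
  by (simp add: relation_def algebra_simps)

lemma relation_abs:
  assumes "relation a b c x y z" "0 \<le> y * z"
  shows "\<bar>x\<bar> * int a = \<bar>y\<bar> * int b + \<bar>z\<bar> * int c"
proof -
  have "\<bar>y * int b + z * int c\<bar> = \<bar>y * int b\<bar> + \<bar>z * int c\<bar>"
  proof -
    consider (nonneg) "0 \<le> y" "0 \<le> z" | (nonpos) "y \<le> 0" "z \<le> 0"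
      using assms(2) by (auto simp: zero_le_mult_iff)
    then show ?thesis
    proof cases
      case nonneg
      then show ?thesis by simp
    next
      case nonpos
      then have "y * int b \<le> 0" "z * int c \<le> 0" by (simp_all add: mult_nonpos_nonneg)
      then show ?thesis by linarith
    qed
  qed
  moreover have "x * int a = - (y * int b + z * int c)" using assms(1) by (simp add: relation_def)
  then have "\<bar>x * int a\<bar> = \<bar>y * int b + z * int c\<bar>" by (simp only: abs_minus_cancel)
  ultimately show ?thesis by (simp add: abs_mult)
qed

lemma sg2_commute: "sg2 a b = sg2 b a"
proof -
  have "sg2 a b \<subseteq> sg2 b a" for a b
    unfolding sg2_def by clarify (metis add.commute)
  then show ?thesis by blast
qed

lemma cmin_commute: "cmin a b c = cmin a c b"
  unfolding cmin_def sg2_commute[of b c] ..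

lemma
  assumes "0 < b"
  shows cmin_pos: "0 < cmin a b c" and cmin_mult_mem: "cmin a b c * a \<in> sg2 b c"
proof -
  have "b * a = a * b + 0 * c" by simp
  then have "0 < b \<and> b * a \<in> sg2 b c" using assms unfolding sg2_def by blast
  from LeastI[of "\<lambda>m. 0 < m \<and> m * a \<in> sg2 b c", OF this]
  show "0 < cmin a b c" "cmin a b c * a \<in> sg2 b c" by (simp_all add: cmin_def)
qed

lemma cmin_le_abs:
  assumes "relation a b c x y z" "0 \<le> y * z" "x \<noteq> 0"
  shows "int (cmin a b c) \<le> \<bar>x\<bar>"
proof -
  have "int (nat \<bar>x\<bar> * a) = int (nat \<bar>y\<bar> * b + nat \<bar>z\<bar> * c)"
    using relation_abs[OF assms(1,2)] by simp
  then have "nat \<bar>x\<bar> * a \<in> sg2 b c" unfolding sg2_def by (simp only: of_nat_eq_iff) blast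
  then have "cmin a b c \<le> nat \<bar>x\<bar>" unfolding cmin_def using assms(3) by (intro Least_le) simp
  then show ?thesis by simp
qed

lemma relation_eq_zero_if_less_cmin:
  assumes "relation a b c x y z" "0 \<le> y * z" "\<bar>x\<bar> < int (cmin a b c)" "0 < b" "0 < c"
  shows "x = 0 \<and> y = 0 \<and> z = 0"
proof -
  have "x = 0" using cmin_le_abs[OF assms(1,2)] assms(3) by linarith
  then have "\<bar>y\<bar> * int b + \<bar>z\<bar> * int c = 0" using relation_abs[OF assms(1,2)] by simp
  then show ?thesis using \<open>x = 0\<close> assms(4,5) by (simp add: add_nonneg_eq_0_iff)
qed

lemma relation_eq_zero_if_all_less_cmin:
  assumes rel: "relation a b c x y z" and pos: "0 < a" "0 < b" "0 < c"
    and less: "\<bar>x\<bar> < int (cmin a b c)" "\<bar>y\<bar> < int (cmin b a c)" "\<bar>z\<bar> < int (cmin c a b)"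
  shows "x = 0 \<and> y = 0 \<and> z = 0"
proof -
  have rels: "relation b a c y x z" "relation c a b z x y"
    using rel relation_swap12 relation_swap23 by blast+
  consider (yz) "0 \<le> y * z" | (xz) "0 \<le> x * z" | (xy) "0 \<le> x * y"
    unfolding zero_le_mult_iff by linarith
  then show ?thesis
  proof cases
    case yz
    then show ?thesis using relation_eq_zero_if_less_cmin[OF rel _ less(1)] pos by blast
  next
    case xz
    then show ?thesis using relation_eq_zero_if_less_cmin[OF rels(1) _ less(2)] pos by blast
  next
    case xy
    then show ?thesis using relation_eq_zero_if_less_cmin[OF rels(2) _ less(3)] pos by blast
  qed
qed

lemma symmetric_sg_if_cmin_multiple:
  assumes pos: "0 < a" "0 < b" "0 < c" and gcd: "gcd (gcd a b) c = 1"
    and multiple: "cmin a b c * a = u * b"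
  shows "symmetric_sg (sg3 a b c)"
proof -
  define d where "d = gcd a b"
  obtain a' b' where ab: "a = d * a'" "b = d * b'" "coprime a' b'"
    using gcd_coprime_exists[of a b] pos unfolding d_def
    by (metis gcd_eq_0_iff mult.commute not_gr0)
  have d: "0 < d" "0 < a'" "0 < b'" using pos ab by auto
  have "cmin a b c * a' = u * b'" using multiple d by (simp add: ab)
  then have "b' dvd cmin a b c * a'" by simp
  then have "b' dvd cmin a b c" using ab(3) by (simp add: coprime_dvd_mult_left_iff coprime_commute)
  then have b'_le: "b' \<le> cmin a b c" using cmin_pos[OF pos(2)] by (intro dvd_imp_le)
  obtain x y where xy: "int c = x * int a' + y * int b'" "0 \<le> x" "x < int b'"
    using coprime_linear_normal_form[of "int a'" "int b'" "int c"] ab(3) d by auto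
  have "0 \<le> y"
  proof (rule ccontr)
    assume "\<not> 0 \<le> y"
    have "relation a b c x y (- int d)"
      by (simp add: relation_def ab xy(1) algebra_simps)
    moreover have "0 \<le> y * - int d" using \<open>\<not> 0 \<le> y\<close> by (simp add: mult_nonpos_nonneg)
    moreover have "y * int b' < 0" using \<open>\<not> 0 \<le> y\<close> d by (simp add: mult_neg_pos)
    then have "x \<noteq> 0" using xy(1) by auto
    ultimately show False using cmin_le_abs b'_le xy(2,3) by fastforce
  qed
  then have "int c \<in> int ` sg2 a' b'" unfolding int_sg2_iff using xy(1,2) by blast
  then have "c \<in> sg2 a' b'" by auto
  moreover have "coprime c d" using gcd by (simp add: d_def coprime_iff_gcd_eq_1 gcd.commute)
  ultimately have "symmetric_sg (sg3 (d * a') (d * b') c)"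
    using symmetric_sg_gluing[OF ab(3) _ d(3,1)] by blast
  then show ?thesis using ab(1,2) by simp
qed

section \<open>Herzog's relations\<close>

lemma sg3_swap12: "sg3 a b c = sg3 b a c"
proof -
  have "sg3 a b c \<subseteq> sg3 b a c" for a b
    unfolding sg3_def by clarify (metis add.commute)
  then show ?thesis by blast
qed

lemma sg3_swap23: "sg3 a b c = sg3 a c b"
proof -
  have "sg3 a b c \<subseteq> sg3 a c b" for b c
    unfolding sg3_def by clarify (metis add.commute add.assoc)
  then show ?thesis by blast
qed

locale nonsymmetric_triple =
  fixes n1 n2 n3 :: nat
  assumes pos: "0 < n1" "0 < n2" "0 < n3"
    and gcd_eq_1: "gcd (gcd n1 n2) n3 = 1"
    and nonsymmetric: "\<not> symmetric_sg (sg3 n1 n2 n3)"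
begin

lemma swap12: "nonsymmetric_triple n2 n1 n3"
  using pos gcd_eq_1 nonsymmetric
  by unfold_locales (simp_all add: gcd.commute[of n2 n1] sg3_swap12[of n2 n1])

lemma swap23: "nonsymmetric_triple n1 n3 n2"
  using pos gcd_eq_1 nonsymmetric
  by unfold_locales (simp_all add: gcd.assoc gcd.commute[of n3 n2] sg3_swap23[of n1 n3])

lemma cmin_coeff2_pos:
  assumes "cmin n1 n2 n3 * n1 = u * n2 + v * n3"
  shows "0 < v"
proof (rule ccontr)
  assume "\<not> 0 < v"
  then have "cmin n1 n2 n3 * n1 = u * n2" using assms by simp
  then show False using symmetric_sg_if_cmin_multiple[OF pos gcd_eq_1] nonsymmetric by blast
qed

lemma cmin_coeff1_pos:
  assumes "cmin n1 n2 n3 * n1 = u * n2 + v * n3"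
  shows "0 < u"
  using nonsymmetric_triple.cmin_coeff2_pos[OF swap23, of v u] assms
  by (simp add: cmin_commute[of n1 n3] add.commute)

lemma cmin_representation:
  obtains u v where "cmin n1 n2 n3 * n1 = u * n2 + v * n3"
  using cmin_mult_mem[OF pos(2), of n1 n3] unfolding sg2_def by blast

end

lemma relation_if_multiple:
  "k * a = u * b + v * c \<Longrightarrow> relation a b c (int k) (- int u) (- int v)"
  unfolding relation_def by (simp flip: of_nat_mult of_nat_add)

text \<open>If cmin n2 n1 n3 were at most u, then subtracting the minimal relation of n2 would give a
  smaller multiple of n1.\<close>
lemma (in nonsymmetric_triple) cmin_coeff1_less:
  assumes "cmin n1 n2 n3 * n1 = u * n2 + v * n3"
  shows "u < cmin n2 n1 n3"
proof (rule ccontr)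
  assume "\<not> ?thesis"
  then have le: "cmin n2 n1 n3 \<le> u" by simp
  interpret swap: nonsymmetric_triple n2 n1 n3 by (fact swap12)
  obtain s t where st: "cmin n2 n1 n3 * n2 = s * n1 + t * n3"
    using swap.cmin_representation .
  have "0 < s" "0 < t" using swap.cmin_coeff1_pos[OF st] swap.cmin_coeff2_pos[OF st] .
  let ?x = "int (cmin n1 n2 n3) - int s" and ?y = "int (cmin n2 n1 n3) - int u"
  let ?z = "- int v - int t"
  have "relation n1 n2 n3 (- int s) (int (cmin n2 n1 n3)) (- int t)"
    using relation_if_multiple[OF st] by (simp add: relation_swap12)
  then have rel: "relation n1 n2 n3 ?x ?y ?z"
    using relation_if_multiple[OF assms] by (simp add: relation_def algebra_simps)
  have "?y * int n2 \<le> 0" "?z * int n3 < 0"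
    using le \<open>0 < t\<close> pos by (simp_all add: mult_nonpos_nonneg mult_neg_pos)
  then have "0 < ?x * int n1" using rel by (simp add: relation_def)
  then have "0 < ?x" using pos by (simp add: zero_less_mult_iff)
  then have "\<bar>?x\<bar> < int (cmin n1 n2 n3)" using \<open>0 < s\<close> by simp
  moreover have "0 \<le> ?y * ?z" using le by (intro mult_nonpos_nonpos) auto
  ultimately show False
    using relation_eq_zero_if_less_cmin[OF rel] pos \<open>0 < ?x\<close> by simp
qed

context nonsymmetric_triple
begin

lemma cmin_coeffs_unique:
  assumes uv: "cmin n1 n2 n3 * n1 = u * n2 + v * n3"
    and uv': "cmin n1 n2 n3 * n1 = u' * n2 + v' * n3"
  shows "u = u' \<and> v = v'"
proof -
  have "relation n2 n1 n3 (int u - int u') 0 (int v - int v')"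
    using relation_if_multiple[OF uv] relation_if_multiple[OF uv']
    by (simp add: relation_def algebra_simps)
  moreover have "\<bar>int u - int u'\<bar> < int (cmin n2 n1 n3)"
    using cmin_coeff1_less[OF uv] cmin_coeff1_less[OF uv'] by simp
  ultimately show ?thesis using relation_eq_zero_if_less_cmin[of n2 n1 n3] pos by fastforce
qed

lemma rpair_eqI:
  assumes "cmin n1 n2 n3 * n1 = u * n2 + v * n3"
  shows "rpair n1 n2 n3 = (u, v)"
  unfolding rpair_def
proof (rule the_equality)
  show "case (u, v) of (u, v) \<Rightarrow> 0 < u \<and> 0 < v \<and> cmin n1 n2 n3 * n1 = u * n2 + v * n3"
    using assms cmin_coeff1_pos cmin_coeff2_pos by auto
qed (use cmin_coeffs_unique[OF _ assms] in blast)

lemma cmin_mult_eq_rpair: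
  "cmin n1 n2 n3 * n1 = fst (rpair n1 n2 n3) * n2 + snd (rpair n1 n2 n3) * n3"
  using cmin_representation rpair_eqI by (metis fst_conv snd_conv)

lemma rpair_pos: "0 < fst (rpair n1 n2 n3)" "0 < snd (rpair n1 n2 n3)"
  using cmin_coeff1_pos cmin_coeff2_pos cmin_mult_eq_rpair by blast+

lemma rpair_less: "fst (rpair n1 n2 n3) < cmin n2 n1 n3" "snd (rpair n1 n2 n3) < cmin n3 n1 n2"
proof -
  interpret swap: nonsymmetric_triple n1 n3 n2 by (fact swap23)
  show "fst (rpair n1 n2 n3) < cmin n2 n1 n3" using cmin_coeff1_less[OF cmin_mult_eq_rpair] .
  show "snd (rpair n1 n2 n3) < cmin n3 n1 n2"
    using swap.cmin_coeff1_less[of "snd (rpair n1 n2 n3)" "fst (rpair n1 n2 n3)"]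
      cmin_mult_eq_rpair
    by (simp add: cmin_commute[of n1 n3] add.commute)
qed

end

context vector_pair
begin

lemma relation_coords:
  assumes "relation n1 n2 n3 c1 (- r12) (- r13)" "relation n1 n2 n3 (- r31) (- r32) c3"
  shows "relation n1 n2 n3 (coord1 a b) (coord2 a b) (coord3 a b)"
proof -
  have "coord1 a b * int n1 + coord2 a b * int n2 + coord3 a b * int n3
      = a * (c1 * int n1 + (- r12) * int n2 + (- r13) * int n3)
      + b * ((- r31) * int n1 + (- r32) * int n2 + c3 * int n3)"
    unfolding coord_defs by (simp add: algebra_simps)
  then show ?thesis using assms by (simp add: relation_def)
qed

lemma relation_coord2:
  assumes basis: "relation n1 n2 n3 c1 (- r12) (- r13)" "relation n1 n2 n3 (- r31) (- r32) c3"
    and w: "relation n1 n2 n3 w1 w2 w3" and "0 < n2"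
    and "D * w1 = coord1 s t" "D * w3 = coord3 s t"
  shows "D * w2 = coord2 s t"
proof -
  have "D * (w1 * int n1 + w2 * int n2 + w3 * int n3) = 0" using w by (simp add: relation_def)
  then have "relation n1 n2 n3 (D * w1) (D * w2) (D * w3)"
    by (simp add: relation_def algebra_simps)
  from relation_diff[OF this relation_coords[OF basis, of s t]]
  have "relation n1 n2 n3 0 (D * w2 - coord2 s t) 0" using assms(5,6) by simp
  then show ?thesis using \<open>0 < n2\<close> by (simp add: relation_def)
qed

text \<open>Reduction into the half-open parallelogram spanned by v1 and v3, in Cramer coordinates
  (s / D, t / D).\<close>
lemma relation_parallelogramE:
  assumes basis: "relation n1 n2 n3 c1 (- r12) (- r13)" "relation n1 n2 n3 (- r31) (- r32) c3"
    and z: "relation n1 n2 n3 z1 z2 z3"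
    and "0 < n2" and D_def: "D = c1 * c3 - r13 * r31" and "0 < D"
  obtains a b w1 w2 w3 s t where "relation n1 n2 n3 w1 w2 w3"
    and "z1 = coord1 a b + w1" "z2 = coord2 a b + w2" "z3 = coord3 a b + w3"
    and "D * w1 = coord1 s t" "D * w2 = coord2 s t" "D * w3 = coord3 s t"
    and "0 \<le> s" "s < D" "0 \<le> t" "t < D"
proof -
  define S T where "S = z1 * c3 + z3 * r31" and "T = z1 * r13 + z3 * c1"
  define a b s t where "a = S div D" and "b = T div D" and "s = S mod D" and "t = T mod D"
  define w1 w2 w3 where w: "w1 = z1 - coord1 a b" "w2 = z2 - coord2 a b" "w3 = z3 - coord3 a b"
  have rel_w: "relation n1 n2 n3 w1 w2 w3"
    unfolding w using relation_diff[OF z relation_coords[OF basis]] .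
  have S: "S = a * D + s" and T: "T = b * D + t" by (simp_all add: a_def b_def s_def t_def)
  have "D * z1 = coord1 S T" "D * z3 = coord3 S T"
    by (simp_all add: D_def S_def T_def coord_defs algebra_simps)
  then have w13: "D * w1 = coord1 s t" "D * w3 = coord3 s t"
    unfolding S T w coord_defs by (simp_all add: algebra_simps)
  have w2: "D * w2 = coord2 s t"
    using relation_coord2[OF basis rel_w \<open>0 < n2\<close> w13] .
  have decomp: "z1 = coord1 a b + w1" "z2 = coord2 a b + w2" "z3 = coord3 a b + w3"
    by (simp_all add: w)
  have st: "0 \<le> s" "s < D" "0 \<le> t" "t < D" using \<open>0 < D\<close> by (simp_all add: s_def t_def)
  show ?thesis using that[OF rel_w decomp w13(1) w2 w13(2) st] .
qed

end

lemma (in signed_vector_pair) relation_in_span: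
  assumes basis: "relation n1 n2 n3 c1 (- r12) (- r13)" "relation n1 n2 n3 (- r31) (- r32) c3"
    and z: "relation n1 n2 n3 z1 z2 z3" and n2: "0 < n2"
    and small: "\<And>w1 w2 w3. relation n1 n2 n3 w1 w2 w3 \<Longrightarrow>
      \<bar>w1\<bar> < c1 \<Longrightarrow> \<bar>w2\<bar> < r12 + r32 \<Longrightarrow> \<bar>w3\<bar> < c3 \<Longrightarrow> w1 = 0 \<and> w2 = 0 \<and> w3 = 0"
  shows "\<exists>a b. z1 = coord1 a b \<and> z2 = coord2 a b \<and> z3 = coord3 a b"
proof -
  define D where "D = c1 * c3 - r13 * r31"
  have "r31 * r13 < c1 * c3" using r_pos r_less by (intro mult_strict_mono) auto
  then have D: "0 < D" by (simp add: D_def mult.commute)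
  obtain a b w1 w2 w3 s t where w: "relation n1 n2 n3 w1 w2 w3"
    and decomp: "z1 = coord1 a b + w1" "z2 = coord2 a b + w2" "z3 = coord3 a b + w3"
    and Dw: "D * w1 = coord1 s t" "D * w2 = coord2 s t" "D * w3 = coord3 s t"
    and st: "0 \<le> s" "s < D" "0 \<le> t" "t < D"
    by (rule relation_parallelogramE[OF basis z n2 D_def D])
  have bound: "\<bar>u\<bar> < k" if "\<bar>D * u\<bar> < D * k" for u k using that D by (simp add: abs_mult)
  have c: "0 < c1" "0 < c3" using r_pos r_less by simp_all
  have "0 \<le> s * c1" "0 \<le> s * r12" "0 \<le> s * r13" "0 \<le> t * r31" "0 \<le> t * r32" "0 \<le> t * c3"
    using st r_pos c by simp_all
  moreover have "s * c1 < D * c1" "s * r12 < D * r12" "s * r13 < D * r13"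
    "t * r31 < D * r31" "t * r32 < D * r32" "t * c3 < D * c3"
    using st r_pos c by simp_all
  moreover have "D * r31 < D * c1" "D * r13 < D * c3" using D r_less by simp_all
  ultimately have "\<bar>D * w1\<bar> < D * c1" "\<bar>D * w2\<bar> < D * (r12 + r32)" "\<bar>D * w3\<bar> < D * c3"
    unfolding Dw coord_defs distrib_left mult_minus_left by linarith+
  then have "w1 = 0 \<and> w2 = 0 \<and> w3 = 0" using small[OF w] bound by blast
  with decomp show ?thesis by auto
qed

context nonsymmetric_triple
begin

abbreviation "c1 \<equiv> int (cmin n1 n2 n3)"
abbreviation "c2 \<equiv> int (cmin n2 n1 n3)"
abbreviation "c3 \<equiv> int (cmin n3 n1 n2)"
abbreviation "r12 \<equiv> int (fst (rpair n1 n2 n3))"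
abbreviation "r13 \<equiv> int (snd (rpair n1 n2 n3))"
abbreviation "r21 \<equiv> int (fst (rpair n2 n1 n3))"
abbreviation "r23 \<equiv> int (snd (rpair n2 n1 n3))"
abbreviation "r31 \<equiv> int (fst (rpair n3 n1 n2))"
abbreviation "r32 \<equiv> int (snd (rpair n3 n1 n2))"

lemma rotate: "nonsymmetric_triple n3 n1 n2"
  using nonsymmetric_triple.swap12[OF swap23] .

lemma coeffs_pos: "0 < r12" "0 < r13" "0 < r21" "0 < r23" "0 < r31" "0 < r32"
  using rpair_pos nonsymmetric_triple.rpair_pos[OF swap12]
    nonsymmetric_triple.rpair_pos[OF rotate]
  by simp_all

lemma coeffs_less: "r12 < c2" "r13 < c3" "r21 < c1" "r23 < c3" "r31 < c1" "r32 < c2"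
  using rpair_less nonsymmetric_triple.rpair_less[OF swap12]
    nonsymmetric_triple.rpair_less[OF rotate]
  by (simp_all add: cmin_commute)

lemma cmin_relations:
  "relation n1 n2 n3 c1 (- r12) (- r13)"
  "relation n1 n2 n3 (- r21) c2 (- r23)"
  "relation n1 n2 n3 (- r31) (- r32) c3"
  using relation_if_multiple[OF cmin_mult_eq_rpair]
    relation_if_multiple[OF nonsymmetric_triple.cmin_mult_eq_rpair[OF swap12]]
    relation_if_multiple[OF nonsymmetric_triple.cmin_mult_eq_rpair[OF rotate]]
  by (simp_all add: relation_def)

lemma c2_eq: "c2 = r12 + r32"
proof -
  have rel: "relation n1 n2 n3 (c1 - r21 - r31) (c2 - r12 - r32) (c3 - r13 - r23)"
    using cmin_relations by (simp add: relation_def algebra_simps)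
  have "\<bar>c1 - r21 - r31\<bar> < c1" "\<bar>c2 - r12 - r32\<bar> < c2" "\<bar>c3 - r13 - r23\<bar> < c3"
    using coeffs_pos coeffs_less by linarith+
  then show ?thesis using relation_eq_zero_if_all_less_cmin[OF rel pos] by simp
qed

sublocale signed_vector_pair c1 r12 r13 r31 r32 c3
  by unfold_locales (fact coeffs_pos coeffs_less)+

lemma relation_iff_coords:
  "relation n1 n2 n3 z1 z2 z3 \<longleftrightarrow> (\<exists>a b. z1 = coord1 a b \<and> z2 = coord2 a b \<and> z3 = coord3 a b)"
proof
  assume z: "relation n1 n2 n3 z1 z2 z3"
  have small: "w1 = 0 \<and> w2 = 0 \<and> w3 = 0"
    if "relation n1 n2 n3 w1 w2 w3" "\<bar>w1\<bar> < c1" "\<bar>w2\<bar> < r12 + r32" "\<bar>w3\<bar> < c3" for w1 w2 w3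
    using relation_eq_zero_if_all_less_cmin[OF that(1) pos] that c2_eq by simp
  show "\<exists>a b. z1 = coord1 a b \<and> z2 = coord2 a b \<and> z3 = coord3 a b"
    using relation_in_span[OF cmin_relations(1,3) z pos(2) small] .
next
  assume "\<exists>a b. z1 = coord1 a b \<and> z2 = coord2 a b \<and> z3 = coord3 a b"
  then show "relation n1 n2 n3 z1 z2 z3" using relation_coords[OF cmin_relations(1,3)] by blast
qed

end

section \<open>The delta set of a nonsymmetric triple\<close>

locale ordered_nonsymmetric_triple = nonsymmetric_triple +
  assumes n_less: "n1 < n2" "n2 < n3"
begin

abbreviation "\<delta>1 \<equiv> c1 - r12 - r13"
abbreviation "\<delta>3 \<equiv> r31 + r32 - c3"

lemma length_differences_pos: "0 < \<delta>1" "0 < \<delta>3"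
proof -
  have "r12 * int n1 < r12 * int n2" "r13 * int n1 < r13 * int n3"
    using n_less r_pos by simp_all
  then have "(r12 + r13) * int n1 < c1 * int n1"
    using cmin_relations(1) by (simp add: relation_def algebra_simps)
  then show "0 < \<delta>1" by (simp only: mult_less_cancel_right) linarith
  have "r31 * int n1 < r31 * int n3" "r32 * int n2 < r32 * int n3"
    using n_less r_pos by simp_all
  then have "c3 * int n3 < (r31 + r32) * int n3"
    using cmin_relations(3) by (simp add: relation_def algebra_simps)
  then show "0 < \<delta>3" by (simp only: mult_less_cancel_right) linarith
qed

text \<open>The relation \<delta>3 v1 + \<delta>1 v3 has length 0, hence is proportional to
  (n3 - n2, n1 - n3, n2 - n1).\<close>
lemma slopes: "\<delta>1 * r31 < \<delta>3 * c1" "\<delta>3 * r13 < \<delta>1 * c3"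
proof -
  define u1 u3 where u: "u1 = coord1 \<delta>3 \<delta>1" "u3 = coord3 \<delta>3 \<delta>1"
  have u2: "coord2 \<delta>3 \<delta>1 = - (u1 + u3)" unfolding u coord_defs by (simp add: algebra_simps)
  have "0 < \<delta>3 * r12" "0 < \<delta>1 * r32" using length_differences_pos r_pos by simp_all
  then have pos: "0 < u1 + u3" using u2 unfolding coord2_def by linarith
  have "u1 * int n1 + - (u1 + u3) * int n2 + u3 * int n3 = 0"
    using relation_coords[OF cmin_relations(1,3), of \<delta>3 \<delta>1] unfolding relation_def u2 u .
  then have eq: "u1 * (int n2 - int n1) = u3 * (int n3 - int n2)" by (simp add: algebra_simps)
  have "0 < int n2 - int n1" "0 < int n3 - int n2" using n_less by auto
  with eq have "0 < u1 \<longleftrightarrow> 0 < u3" by (metis zero_less_mult_pos2 mult_pos_pos)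
  with pos have "0 < u1" "0 < u3" by auto
  then show "\<delta>1 * r31 < \<delta>3 * c1" "\<delta>3 * r13 < \<delta>1 * c3" unfolding u coord_defs by simp_all
qed

sublocale measured_vector_pair c1 r12 r13 r31 r32 c3 \<delta>1 \<delta>3
  by unfold_locales (fact r_pos r_less length_differences_pos slopes)+

lemma sum_coords: "coord1 a b + coord2 a b + coord3 a b = len a b"
  unfolding coord_defs len_def by (simp add: algebra_simps)

lemma gap_relation_coords_iff:
  "gap_relation n1 n2 n3 (coord1 a b) (coord2 a b) (coord3 a b) \<longleftrightarrow> gap a b"
proof -
  have "relation n1 n2 n3 (coord1 a b) (coord2 a b) (coord3 a b)"
    unfolding relation_iff_coords by blast
  moreover have "(\<exists>w1 w2 w3. relation n1 n2 n3 w1 w2 w3 \<and> P w1 w2 w3) \<longleftrightarrow>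
      (\<exists>a' b'. P (coord1 a' b') (coord2 a' b') (coord3 a' b'))" for P
    unfolding relation_iff_coords by blast
  ultimately show ?thesis
    by (simp add: gap_relation_def gap_def intermediate_def sum_coords)
qed

lemma delta_set_eq_irreducible_values:
  "delta_set n1 n2 n3 = irreducible_values \<delta>1 \<delta>3 \<union> irreducible_values \<delta>3 \<delta>1"
proof -
  have "delta_set n1 n2 n3 = {len a b | a b. gap a b}"
  proof (intro equalityI subsetI)
    fix d assume "d \<in> delta_set n1 n2 n3"
    then obtain z1 z2 z3 where gap: "gap_relation n1 n2 n3 z1 z2 z3" and d: "d = z1 + z2 + z3"
      by (rule gap_relation_if_mem_delta_set)
    then have "relation n1 n2 n3 z1 z2 z3" unfolding gap_relation_def by blast
    then obtain a b where "z1 = coord1 a b" "z2 = coord2 a b" "z3 = coord3 a b"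
      unfolding relation_iff_coords by blast
    then have "gap a b" "d = len a b"
      using gap d by (simp_all add: gap_relation_coords_iff sum_coords)
    then show "d \<in> {len a b | a b. gap a b}" by blast
  next
    fix d assume "d \<in> {len a b | a b. gap a b}"
    then show "d \<in> delta_set n1 n2 n3"
      using mem_delta_set_if_gap_relation gap_relation_coords_iff sum_coords by fastforce
  qed
  then show ?thesis using gap_lengths by simp
qed

end

theorem theorem2p15:
  fixes n1 n2 n3 :: nat
  assumes "0 < n1" and "n1 < n2" and "n2 < n3"
    and "gcd (gcd n1 n2) n3 = 1"
    and "minimally_generated n1 n2 n3"
    and "\<not> symmetric_sg (sg3 n1 n2 n3)"
  shows
    "let c1 = int (cmin n1 n2 n3); c3 = int (cmin n3 n1 n2);
         r12 = int (fst (rpair n1 n2 n3)); r13 = int (snd (rpair n1 n2 n3));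
         r31 = int (fst (rpair n3 n1 n2)); r32 = int (snd (rpair n3 n1 n2));
         d1 = c1 - r12 - r13; d3 = r31 + r32 - c3;
         g = gcd d1 d3; p = d1 div g; q = d3 div g
     in delta_set n1 n2 n3 =
        {g * i | i. i \<in> {1..max p q} \<and> (lambda_irred p q i \<or> mu_irred p q i)}"
proof -
  interpret ordered_nonsymmetric_triple n1 n2 n3 using assms by unfold_locales simp_all
  define g p q where gpq: "g = gcd \<delta>1 \<delta>3" "p = \<delta>1 div g" "q = \<delta>3 div g"
  have g: "0 < g" and \<delta>: "\<delta>1 = g * p" "\<delta>3 = g * q" using \<delta>_pos by (simp_all add: gpq)
  have pq: "0 < p" "0 < q" using \<delta>_pos g unfolding \<delta> by (simp_all add: zero_less_mult_iff)
  have coprime: "coprime p q" unfolding gpq using \<delta>_pos by (intro div_gcd_coprime) auto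
  have "delta_set n1 n2 n3 = (*) g ` (irreducible_values p q \<union> irreducible_values q p)"
    unfolding delta_set_eq_irreducible_values \<delta> irreducible_values_scale[OF g] by blast
  also have "\<dots> = {g * i | i. i \<in> {1..max p q} \<and> (lambda_irred p q i \<or> mu_irred p q i)}"
    unfolding irreducible_values_eq_lambda_irred[OF coprime pq]
      irreducible_values_eq_mu_irred[OF coprime pq] by blast
  finally show ?thesis unfolding gpq Let_def .
qed

end
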